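(* Let $n$ be a positive integer and run the following algorithm (Algorithm A) on input $n$: <br/> $k\leftarrow 1$; $x\leftarrow 1$; $y\leftarrow n-1$;<br/> while $k>0$ do:<br/> while $2x\le y$ do: $a_k\leftarrow x$; $y\leftarrow y-x$; $k\leftarrow k+1$; end while;<br/> $t\leftarrow k+1$;<br/> while $x\le y$ do: $a_k\leftarrow x$; $a_t\leftarrow y$; visit $a_1,\ldots,a_t$; $x\leftarrow x+1$; $y\leftarrow y-1$; end while;<br/> $y\leftarrow x+y-1$; $a_k\leftarrow y+1$; visit $a_1,\ldots,a_k$; $k\leftarrow k-1$; $x\leftarrow a_k+1$;<br/> end while. <br/> Then Algorithm A terminates after executing exactly $4p(n)+4p^{(2)}(n)$ assignment statements and evaluating exactly $p(n)+3p^{(2)}(n)$ boolean expressions.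
   Context: All variables are integers; $a_0,a_1,a_2,\ldots$ is an array of integer cells (with $a_0$ present, holding an arbitrary value). An "assignment statement" is one execution of a statement of the form $v\leftarrow e$; a "boolean expression evaluation" is one evaluation of the condition of a while loop (each test, including the final failing test, counts once). "visit" statements are not counted. $p(n)$ is the number of partitions of $n$ (unordered representations as sums of positive integers). $p^{(2)}(n)$ is the number of partitions $\lambda=[\lambda_1\ge\lambda_2\ge\cdots]$ of $n$ with $\lambda_1\ge 2\lambda_2$, where the one-part partition $[n]$ is considered to satisfy this condition. *)

theory Defs
  imports Main
begin

datatype vname = vk | vx | vy | vt | vn

datatype aexp =
    Num int
  | Var vname
  | Cell vname
  | Plus aexp aexp
  | Minus aexp aexp
  | Times aexp aexp

datatype bexp =
    Less aexp aexp
  | Leq aexp aexp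

text \<open>\<open>Visit v\<close> stands for visiting the cells with indices \<open>1\<close> up to the value of \<open>v\<close>.\<close>

datatype com =
    Assign vname aexp      ("_ ::= _" [1000, 61] 61)
  | AssignCell vname aexp  ("CELL _ ::= _" [1000, 61] 61)
  | Visit vname
  | Seq com com            (infixr ";;" 60)
  | While bexp com         ("(WHILE _/ DO _)" [0, 61] 61)

type_synonym state = "(vname \<Rightarrow> int) \<times> (nat \<Rightarrow> int)"

definition lift2 :: "('a \<Rightarrow> 'b \<Rightarrow> 'c) \<Rightarrow> 'a option \<Rightarrow> 'b option \<Rightarrow> 'c option" where
  "lift2 f u v = Option.bind u (\<lambda>i. Option.bind v (\<lambda>j. Some (f i j)))"

text \<open>There are no cells with negative index: reading or writing such a cell is an error,
  in which case the execution gets stuck.\<close>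

fun aval :: "aexp \<Rightarrow> state \<Rightarrow> int option" where
  "aval (Num i) (\<sigma>, a) = Some i"
| "aval (Var v) (\<sigma>, a) = Some (\<sigma> v)"
| "aval (Cell v) (\<sigma>, a) = (if 0 \<le> \<sigma> v then Some (a (nat (\<sigma> v))) else None)"
| "aval (Plus e f) s = lift2 (+) (aval e s) (aval f s)"
| "aval (Minus e f) s = lift2 (-) (aval e s) (aval f s)"
| "aval (Times e f) s = lift2 (*) (aval e s) (aval f s)"

fun bval :: "bexp \<Rightarrow> state \<Rightarrow> bool option" where
  "bval (Less e f) s = lift2 (<) (aval e s) (aval f s)"
| "bval (Leq e f) s = lift2 (\<le>) (aval e s) (aval f s)"

text \<open>\<open>exec c s A B s'\<close>: the command \<open>c\<close>, started in state \<open>s\<close>, terminates in state \<open>s'\<close> after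
  executing exactly \<open>A\<close> assignment statements and evaluating exactly \<open>B\<close> boolean expressions.\<close>

inductive exec :: "com \<Rightarrow> state \<Rightarrow> nat \<Rightarrow> nat \<Rightarrow> state \<Rightarrow> bool" where
  Assign:
    "aval e (\<sigma>, a) = Some i \<Longrightarrow> exec (v ::= e) (\<sigma>, a) 1 0 (\<sigma>(v := i), a)"
| AssignCell:
    "aval e (\<sigma>, a) = Some i \<Longrightarrow> 0 \<le> \<sigma> v \<Longrightarrow>
      exec (CELL v ::= e) (\<sigma>, a) 1 0 (\<sigma>, a(nat (\<sigma> v) := i))"
| Visit:
    "exec (Visit v) s 0 0 s"
| Seq:
    "exec c s A B s' \<Longrightarrow> exec d s' A' B' s'' \<Longrightarrow> exec (c ;; d) s (A + A') (B + B') s''"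
| WhileFalse:
    "bval b s = Some False \<Longrightarrow> exec (WHILE b DO c) s 0 1 s"
| WhileTrue:
    "bval b s = Some True \<Longrightarrow> exec c s A B s' \<Longrightarrow> exec (WHILE b DO c) s' A' B' s'' \<Longrightarrow>
      exec (WHILE b DO c) s (A + A') (1 + B + B') s''"

lemma exec_deterministic:
  "exec c s A B s' \<Longrightarrow> exec c s A' B' s'' \<Longrightarrow> A' = A \<and> B' = B \<and> s'' = s'"
proof (induction arbitrary: A' B' s'' rule: exec.induct)
  case (Assign e \<sigma> a i v)
  from Assign(2,1) show ?case by cases auto
next
  case (AssignCell e \<sigma> a i v)
  from AssignCell(3,1,2) show ?case by cases auto
next
  case (Visit v s)
  then show ?case by cases auto
next
  case (Seq c s A B s1 d C D s2)
  from Seq.prems show ?case by cases (use Seq.IH in blast)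
next
  case (WhileFalse b s c)
  from WhileFalse(2,1) show ?case by cases auto
next
  case (WhileTrue b s c A B s1 C D s2)
  from WhileTrue.prems show ?case
  proof cases
    case WhileFalse
    then show ?thesis using WhileTrue.hyps by simp
  next
    case WhileTrue
    then show ?thesis using WhileTrue.IH by blast
  qed
qed

definition algorithm_A :: com where
  "algorithm_A =
    vk ::= Num 1 ;;
    vx ::= Num 1 ;;
    vy ::= Minus (Var vn) (Num 1) ;;
    WHILE Less (Num 0) (Var vk) DO (
      WHILE Leq (Times (Num 2) (Var vx)) (Var vy) DO (
        CELL vk ::= Var vx ;;
        vy ::= Minus (Var vy) (Var vx) ;;
        vk ::= Plus (Var vk) (Num 1)
      ) ;;
      vt ::= Plus (Var vk) (Num 1) ;;
      WHILE Leq (Var vx) (Var vy) DO (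
        CELL vk ::= Var vx ;;
        CELL vt ::= Var vy ;;
        Visit vt ;;
        vx ::= Plus (Var vx) (Num 1) ;;
        vy ::= Minus (Var vy) (Num 1)
      ) ;;
      vy ::= Minus (Plus (Var vx) (Var vy)) (Num 1) ;;
      CELL vk ::= Plus (Var vy) (Num 1) ;;
      Visit vk ;;
      vk ::= Minus (Var vk) (Num 1) ;;
      vx ::= Plus (Cell vk) (Num 1)
    )"

text \<open>A partition is represented by the weakly decreasing list of its parts.\<close>

definition partitions :: "nat \<Rightarrow> nat list set" where
  "partitions n = {xs. sorted_wrt (\<ge>) xs \<and> (\<forall>x\<in>set xs. 0 < x) \<and> sum_list xs = n}"

lemma finite_partitions: "finite (partitions n)"
proof (rule finite_subset)
  have "length xs \<le> sum_list xs" if "\<forall>x\<in>set xs. 0 < x" for xs :: "nat list"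
    using that by (induction xs) auto
  then show "partitions n \<subseteq> {xs. set xs \<subseteq> {..n} \<and> length xs \<le> n}"
    by (auto simp: partitions_def member_le_sum_list)
  show "finite {xs. set xs \<subseteq> {..n} \<and> length xs \<le> n}"
    by (rule finite_lists_length_le) simp
qed

definition num_partitions :: "nat \<Rightarrow> nat" where
  "num_partitions n = card (partitions n)"

definition num_partitions2 :: "nat \<Rightarrow> nat" where
  "num_partitions2 n = card {xs \<in> partitions n. 2 \<le> length xs \<longrightarrow> xs ! 0 \<ge> 2 * xs ! 1}"

end

theory Submission
  imports Defs
begin

text \<open>Arriving at the outer test with \<open>k > 0\<close>, the algorithm is about to enumerate the partitions
  of \<open>N = x + y\<close> into parts \<open>\<ge> x = m\<close>, the cells below \<open>k\<close> being fixed; when it is done it is at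
  the outer test with \<open>k - 1\<close>. If \<open>3 m \<le> N\<close>, the first step of the first inner loop (3 assignments,
  1 test) reduces this task to \<open>(m, N - m)\<close> one level up followed by \<open>(m + 1, N)\<close> on the same level.
  If \<open>N < 3 m\<close>, one pass through the outer body does everything, with \<open>4 p + 1\<close> assignments and
  \<open>p + 2\<close> tests for \<open>p\<close> partitions visited. In the resulting binary recursion tree the partitions
  are distributed over the leaves, and the leaves obey the recurrence of the partitions with
  \<open>\<lambda>\<^sub>1 \<ge> 2 \<lambda>\<^sub>2\<close>: removing a smallest part \<open>m \<le> N / 3\<close> preserves this condition in both directions.
  A tree with \<open>L\<close> leaves has \<open>L - 1\<close> inner nodes, which gives \<open>4 p + L + 3 (L - 1)\<close> assignments and
  \<open>p + 2 L + (L - 1)\<close> tests, besides the 3 initial assignments and the last test.\<close>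

section \<open>Partitions with parts bounded below\<close>

definition partitions_ge :: "nat \<Rightarrow> nat \<Rightarrow> nat list set" where
  "partitions_ge m N = {xs \<in> partitions N. \<forall>x\<in>set xs. m \<le> x}"

definition partitions2_ge :: "nat \<Rightarrow> nat \<Rightarrow> nat list set" where
  "partitions2_ge m N = {xs \<in> partitions_ge m N. 2 \<le> length xs \<longrightarrow> xs ! 0 \<ge> 2 * xs ! 1}"

lemma finite_partitions_ge [simp]: "finite (partitions_ge m N)"
  by (simp add: partitions_ge_def finite_partitions)

lemma finite_partitions2_ge [simp]: "finite (partitions2_ge m N)"
  by (simp add: partitions2_ge_def)

lemma partitions_ge_1: "partitions_ge 1 N = partitions N"
  by (auto simp: partitions_ge_def partitions_def Suc_le_eq)

text \<open>Parts decrease, so a part equal to the lower bound \<open>m\<close> can always be placed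
  last. The conjunct \<open>m \<le> N\<close> guards against truncated subtraction: for
  \<open>m > N\<close> the empty list would lie in \<open>partitions_ge m (N - m)\<close>.\<close>

lemma snoc_mem_partitions_ge_iff:
  assumes "0 < m"
  shows "xs @ [m] \<in> partitions_ge m N \<longleftrightarrow> m \<le> N \<and> xs \<in> partitions_ge m (N - m)"
  using assms by (auto simp: partitions_ge_def partitions_def sorted_wrt_append)

text \<open>The last part is the least one: either it equals \<open>m\<close>, or all parts exceed
  \<open>m\<close>. The empty list falls under the first alternative.\<close>

lemma partitions_ge_cases:
  assumes "xs \<in> partitions_ge m N"
  shows "xs \<in> partitions_ge (Suc m) N \<or> (\<exists>ys. xs = ys @ [m])"
proof (cases xs rule: rev_cases)
  case Nil
  then show ?thesis using assms by (auto simp: partitions_ge_def)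
next
  case (snoc ys z)
  then show ?thesis
    using assms
    by (cases "z = m") (fastforce simp: partitions_ge_def partitions_def sorted_wrt_append)+
qed

lemma partitions_ge_split:
  assumes "0 < m" "m \<le> N"
  shows "partitions_ge m N = (\<lambda>xs. xs @ [m]) ` partitions_ge m (N - m) \<union> partitions_ge (Suc m) N"
proof -
  have "partitions_ge (Suc m) N \<subseteq> partitions_ge m N"
    by (auto simp: partitions_ge_def)
  then show ?thesis
    using assms partitions_ge_cases snoc_mem_partitions_ge_iff by blast
qed

lemma snoc_not_mem_partitions_ge_Suc: "xs @ [m] \<notin> partitions_ge (Suc m) N"
  by (simp add: partitions_ge_def)

lemma card_partitions_ge_rec:
  assumes "0 < m" "m \<le> N"
  shows "card (partitions_ge m N) = card (partitions_ge m (N - m)) + card (partitions_ge (Suc m) N)"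
  unfolding partitions_ge_split[OF assms]
  by (subst card_Un_disjoint)
     (auto simp: card_image inj_on_def snoc_not_mem_partitions_ge_Suc)

section \<open>Small sums, where few parts fit\<close>

lemma mem_partitions_ge_length:
  assumes "xs \<in> partitions_ge m N" shows "length xs * m \<le> N"
proof -
  have "length xs * m \<le> sum_list xs" if "\<forall>x\<in>set xs. m \<le> x"
    using that by (induction xs) auto
  then show ?thesis using assms by (auto simp: partitions_ge_def partitions_def)
qed

lemma singleton_mem_partitions2_ge:
  assumes "0 < m" "m \<le> N" shows "[N] \<in> partitions2_ge m N"
  using assms by (auto simp: partitions2_ge_def partitions_ge_def partitions_def)

lemma partitions_ge_singleton:
  assumes "0 < m" "m \<le> N" "N < 2 * m"
  shows "partitions_ge m N = {[N]}"
proof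
  show "partitions_ge m N \<subseteq> {[N]}"
  proof
    fix xs assume xs: "xs \<in> partitions_ge m N"
    then have "length xs * m < 2 * m" using mem_partitions_ge_length[OF xs] assms(3) by linarith
    then have "length xs < 2" by simp
    then show "xs \<in> {[N]}"
      using xs assms by (cases xs) (auto simp: partitions_ge_def partitions_def)
  qed
  show "{[N]} \<subseteq> partitions_ge m N"
    using singleton_mem_partitions2_ge[OF assms(1,2)] by (auto simp: partitions2_ge_def)
qed

text \<open>A second part \<open>v \<ge> m\<close> would force the first to be at least
  \<open>2 * v\<close>, hence a sum of at least \<open>3 * m\<close>.\<close>

lemma partitions2_ge_singleton:
  assumes "0 < m" "m \<le> N" "N < 3 * m"
  shows "partitions2_ge m N = {[N]}"
proof
  show "partitions2_ge m N \<subseteq> {[N]}"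
  proof
    fix xs assume "xs \<in> partitions2_ge m N"
    then have xs: "xs \<in> partitions_ge m N" and two: "2 \<le> length xs \<longrightarrow> xs ! 0 \<ge> 2 * xs ! 1"
      by (auto simp: partitions2_ge_def)
    show "xs \<in> {[N]}"
    proof (cases xs)
      case Nil
      then show ?thesis using xs assms by (auto simp: partitions_ge_def partitions_def)
    next
      case (Cons u ys)
      show ?thesis
      proof (cases ys)
        case Nil
        then show ?thesis using xs Cons by (auto simp: partitions_ge_def partitions_def)
      next
        case (Cons v zs)
        then show ?thesis
          using xs two \<open>xs = u # ys\<close> assms by (auto simp: partitions_ge_def partitions_def)
      qed
    qed
  qed
qed (use singleton_mem_partitions2_ge[OF assms(1,2)] in simp)

text \<open>If \<open>xs\<close> has at least two parts, appending \<open>m\<close> leaves the first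
  two unchanged. If \<open>xs = [N - m]\<close>, the new condition \<open>N - m \<ge> 2 * m\<close>
  is exactly the hypothesis \<open>3 * m \<le> N\<close>. The empty list is excluded on both sides,
  since \<open>m < N\<close>.\<close>

lemma snoc_mem_partitions2_ge_iff:
  assumes "0 < m" "3 * m \<le> N"
  shows "xs @ [m] \<in> partitions2_ge m N \<longleftrightarrow> xs \<in> partitions2_ge m (N - m)"
proof (cases xs)
  case Nil
  then show ?thesis
    using assms by (auto simp: partitions2_ge_def partitions_ge_def partitions_def)
next
  case (Cons u ys)
  then show ?thesis
    using assms
    by (cases ys) (auto simp: partitions2_ge_def partitions_ge_def partitions_def sorted_wrt_append)
qed

lemma card_partitions2_ge_rec:
  assumes "0 < m" "3 * m \<le> N"
  shows "card (partitions2_ge m N) =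
    card (partitions2_ge m (N - m)) + card (partitions2_ge (Suc m) N)"
proof -
  have "partitions2_ge (Suc m) N \<subseteq> partitions2_ge m N"
    by (auto simp: partitions2_ge_def partitions_ge_def)
  moreover have "xs \<in> partitions2_ge (Suc m) N \<or> (\<exists>ys. xs = ys @ [m])"
    if "xs \<in> partitions2_ge m N" for xs
    using that partitions_ge_cases[of xs m N] by (auto simp: partitions2_ge_def)
  ultimately have
    "partitions2_ge m N = (\<lambda>xs. xs @ [m]) ` partitions2_ge m (N - m) \<union> partitions2_ge (Suc m) N"
    using snoc_mem_partitions2_ge_iff[OF assms] by blast
  then show ?thesis
    by (simp, subst card_Un_disjoint)
       (auto simp: card_image inj_on_def partitions2_ge_def snoc_not_mem_partitions_ge_Suc)
qed

section \<open>Executions of the algorithm\<close>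

definition push_body :: com where
  "push_body =
    CELL vk ::= Var vx ;;
    vy ::= Minus (Var vy) (Var vx) ;;
    vk ::= Plus (Var vk) (Num 1)"

definition push_loop :: com where
  "push_loop = WHILE Leq (Times (Num 2) (Var vx)) (Var vy) DO push_body"

definition visit_body :: com where
  "visit_body =
    CELL vk ::= Var vx ;;
    CELL vt ::= Var vy ;;
    Visit vt ;;
    vx ::= Plus (Var vx) (Num 1) ;;
    vy ::= Minus (Var vy) (Num 1)"

definition visit_loop :: com where
  "visit_loop = WHILE Leq (Var vx) (Var vy) DO visit_body"

definition pop :: com where
  "pop =
    vy ::= Minus (Plus (Var vx) (Var vy)) (Num 1) ;;
    CELL vk ::= Plus (Var vy) (Num 1) ;;
    Visit vk ;;
    vk ::= Minus (Var vk) (Num 1) ;;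
    vx ::= Plus (Cell vk) (Num 1)"

definition main_loop :: com where
  "main_loop =
    WHILE Less (Num 0) (Var vk) DO
      (push_loop ;; vt ::= Plus (Var vk) (Num 1) ;; visit_loop ;; pop)"

lemma algorithm_A_eq:
  "algorithm_A = vk ::= Num 1 ;; vx ::= Num 1 ;; vy ::= Minus (Var vn) (Num 1) ;; main_loop"
  by (simp add: algorithm_A_def main_loop_def push_loop_def push_body_def visit_loop_def
      visit_body_def pop_def)

section \<open>Costs of straight-line code\<close>

inductive_cases exec_SeqE: "exec (c ;; d) s A B s'"
inductive_cases exec_WhileE: "exec (WHILE b DO c) s A B s'"

lemma exec_Assign_Seq:
  "aval e (\<sigma>, a) = Some i \<Longrightarrow> exec d (\<sigma>(v := i), a) A B s' \<Longrightarrow>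
    exec (v ::= e ;; d) (\<sigma>, a) (1 + A) B s'"
  using exec.Seq[OF exec.Assign] by fastforce

lemma exec_AssignCell_Seq:
  "0 \<le> \<sigma> v \<Longrightarrow> aval e (\<sigma>, a) = Some i \<Longrightarrow> exec d (\<sigma>, a(nat (\<sigma> v) := i)) A B s' \<Longrightarrow>
    exec (CELL v ::= e ;; d) (\<sigma>, a) (1 + A) B s'"
  using exec.Seq[OF exec.AssignCell] by fastforce

lemma exec_Visit_Seq: "exec d s A B s' \<Longrightarrow> exec (Visit v ;; d) s A B s'"
  using exec.Seq[OF exec.Visit] by fastforce

text \<open>Chaining execution rules produces unsimplified counters and states; this defers their
  comparison with the stated ones to separate equations.\<close>

lemma exec_cong:
  "exec c s A B s' \<Longrightarrow> A' = A \<Longrightarrow> B' = B \<Longrightarrow> t' = s' \<Longrightarrow> exec c s A' B' t'"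
  by simp

lemma exec_push_body:
  assumes "0 \<le> \<sigma> vk"
  shows "exec push_body (\<sigma>, a) 3 0
    (\<sigma>(vy := \<sigma> vy - \<sigma> vx, vk := \<sigma> vk + 1), a(nat (\<sigma> vk) := \<sigma> vx))"
  unfolding push_body_def
  by (rule exec_cong,
      rule exec_AssignCell_Seq, simp add: assms, simp add: lift2_def,
      rule exec_Assign_Seq, simp add: lift2_def,
      rule exec.Assign, simp add: lift2_def)
     simp_all

lemma exec_visit_body:
  assumes "0 \<le> \<sigma> vk" "0 \<le> \<sigma> vt"
  shows "exec visit_body (\<sigma>, a) 4 0
    (\<sigma>(vx := \<sigma> vx + 1, vy := \<sigma> vy - 1), a(nat (\<sigma> vk) := \<sigma> vx, nat (\<sigma> vt) := \<sigma> vy))"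
  unfolding visit_body_def
  by (rule exec_cong,
      rule exec_AssignCell_Seq, simp add: assms, simp add: lift2_def,
      rule exec_AssignCell_Seq, simp add: assms, simp add: lift2_def,
      rule exec_Visit_Seq,
      rule exec_Assign_Seq, simp add: lift2_def,
      rule exec.Assign, simp add: lift2_def)
     simp_all

text \<open>With \<open>x + y = N\<close> on entry, cell \<open>k\<close> receives \<open>N\<close>,
  so the visit here is that of the one-part completion \<open>[N]\<close>. The bound
  \<open>1 \<le> k\<close> makes cell \<open>k - 1\<close> readable; it differs from the cell just
  written.\<close>

lemma exec_pop:
  assumes "1 \<le> \<sigma> vk"
  shows "exec pop (\<sigma>, a) 4 0
    (\<sigma>(vy := \<sigma> vx + \<sigma> vy - 1, vk := \<sigma> vk - 1, vx := a (nat (\<sigma> vk - 1)) + 1),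
     a(nat (\<sigma> vk) := \<sigma> vx + \<sigma> vy))"
  unfolding pop_def
  by (rule exec_cong,
      rule exec_Assign_Seq, simp add: lift2_def,
      rule exec_AssignCell_Seq, use assms in simp, simp add: lift2_def,
      rule exec_Visit_Seq,
      rule exec_Assign_Seq, simp add: lift2_def,
      rule exec.Assign, use assms in \<open>simp add: lift2_def\<close>)
     (use assms in \<open>simp_all add: nat_eq_iff\<close>)

section \<open>The recursion behind the main loop\<close>

text \<open>This lets the induction consider only states at the outer test, although the second
  state actually occurs inside the first inner loop. A run of \<open>main_loop\<close> from there is
  regrouped by prepending one iteration to its first \<open>push_loop\<close>; the outer test is
  paid once in both runs.\<close>

lemma exec_main_loop_push:
  assumes "1 \<le> \<sigma> vk" "2 * \<sigma> vx \<le> \<sigma> vy"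
    and "exec main_loop (\<sigma>(vy := \<sigma> vy - \<sigma> vx, vk := \<sigma> vk + 1), a(nat (\<sigma> vk) := \<sigma> vx)) A B s'"
  shows "exec main_loop (\<sigma>, a) (A + 3) (B + 1) s'"
proof -
  let ?s = "(\<sigma>(vy := \<sigma> vy - \<sigma> vx, vk := \<sigma> vk + 1), a(nat (\<sigma> vk) := \<sigma> vx))"
  let ?rest = "vt ::= Plus (Var vk) (Num 1) ;; visit_loop ;; pop"
  \<comment> \<open>As \<open>k + 1 > 0\<close>, the given run must enter the body and can be taken
    apart.\<close>
  have "bval (Less (Num 0) (Var vk)) ?s = Some True"
    using assms(1) by (simp add: lift2_def)
  then obtain A1 B1 s1 A2 B2 where body: "exec (push_loop ;; ?rest) ?s A1 B1 s1"
      and loop: "exec main_loop s1 A2 B2 s'" and AB: "A = A1 + A2" "B = 1 + B1 + B2"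
    using assms(3) unfolding main_loop_def by (auto elim: exec_WhileE)
  from body obtain A3 B3 s3 A4 B4 where push: "exec push_loop ?s A3 B3 s3"
      and rest: "exec ?rest s3 A4 B4 s1" and AB1: "A1 = A3 + A4" "B1 = B3 + B4"
    by (auto elim: exec_SeqE)
  have "exec push_loop (\<sigma>, a) (3 + A3) (1 + 0 + B3) s3"
    unfolding push_loop_def
    by (rule exec.WhileTrue, simp add: lift2_def assms(2), rule exec_push_body)
       (use assms(1) push in \<open>simp_all add: push_loop_def\<close>)
  then have "exec (push_loop ;; ?rest) (\<sigma>, a) ((3 + A3) + A4) ((1 + 0 + B3) + B4) s1"
    using rest by (rule exec.Seq)
  then have "exec main_loop (\<sigma>, a) (((3 + A3) + A4) + A2) (1 + ((1 + 0 + B3) + B4) + B2) s'"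
    using loop assms(1) unfolding main_loop_def
    by (intro exec.WhileTrue) (simp_all add: lift2_def)
  then show ?thesis by (simp add: AB AB1 algebra_simps)
qed

text \<open>For \<open>N < 3 * m\<close> at most two parts fit: the loop visits the pairs
  \<open>[N - x, x]\<close> with \<open>m \<le> x \<le> N - x\<close>, and \<open>[N]\<close> is
  left to \<open>pop\<close>. So there is one iteration fewer than there are partitions, and the
  failing test makes up the difference in tests; \<open>A + 4\<close> avoids subtraction.\<close>

lemma exec_visit_loop:
  assumes "0 < m" "m \<le> N" "N < 3 * m" "0 < k"
    and "\<sigma> vk = int k" "\<sigma> vt = int (Suc k)" "\<sigma> vx = int m" "\<sigma> vy = int N - int m"
  shows "\<exists>\<sigma>' a' A. exec visit_loop (\<sigma>, a) A (card (partitions_ge m N)) (\<sigma>', a') \<and>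
    A + 4 = 4 * card (partitions_ge m N) \<and>
    \<sigma>' vk = int k \<and> \<sigma>' vx + \<sigma>' vy = int N \<and> (\<forall>i<k. a' i = a i)"
  using assms
proof (induction "N - m" arbitrary: m \<sigma> a rule: less_induct)
  case less
  show ?case
  proof (cases "2 * m \<le> N")
    case False
    then have "card (partitions_ge m N) = 1"
      using less.prems partitions_ge_singleton by simp
    moreover have "exec visit_loop (\<sigma>, a) 0 1 (\<sigma>, a)"
      unfolding visit_loop_def using False less.prems
      by (intro exec.WhileFalse) (simp add: lift2_def)
    ultimately show ?thesis using less.prems by (intro exI[of _ \<sigma>] exI[of _ a] exI[of _ 0]) simp
  next
    case True
    let ?\<sigma> = "\<sigma>(vx := \<sigma> vx + 1, vy := \<sigma> vy - 1)"
    let ?a = "a(nat (\<sigma> vk) := \<sigma> vx, nat (\<sigma> vt) := \<sigma> vy)"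
    have step: "exec visit_body (\<sigma>, a) 4 0 (?\<sigma>, ?a)"
      using less.prems by (intro exec_visit_body) auto
    have "\<exists>\<sigma>' a' A. exec visit_loop (?\<sigma>, ?a) A (card (partitions_ge (Suc m) N)) (\<sigma>', a') \<and>
      A + 4 = 4 * card (partitions_ge (Suc m) N) \<and>
      \<sigma>' vk = int k \<and> \<sigma>' vx + \<sigma>' vy = int N \<and> (\<forall>i<k. a' i = ?a i)"
      by (rule less.hyps) (use True less.prems in auto)
    then obtain \<sigma>' a' A where loop: "exec visit_loop (?\<sigma>, ?a) A (card (partitions_ge (Suc m) N)) (\<sigma>', a')"
      and A: "A + 4 = 4 * card (partitions_ge (Suc m) N)"
      and s': "\<sigma>' vk = int k" "\<sigma>' vx + \<sigma>' vy = int N" "\<forall>i<k. a' i = ?a i"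
      by blast
    \<comment> \<open>Since \<open>m \<le> N - m < 2 * m\<close>, exactly one partition has
      \<open>m\<close> as a part split off the end: \<open>[N - m, m]\<close>, the one visited in
      this iteration.\<close>
    have "card (partitions_ge m N) = 1 + card (partitions_ge (Suc m) N)"
      using card_partitions_ge_rec[of m N] partitions_ge_singleton[of m "N - m"] True less.prems
      by simp
    moreover have "exec visit_loop (\<sigma>, a) (4 + A) (1 + 0 + card (partitions_ge (Suc m) N)) (\<sigma>', a')"
      using step loop True less.prems unfolding visit_loop_def
      by (intro exec.WhileTrue) (simp_all add: lift2_def)
    moreover have "\<forall>i<k. a' i = a i"
      using s'(3) less.prems by (simp add: nat_add_distrib)
    ultimately show ?thesis using A s'(1,2)
      by (intro exI[of _ \<sigma>'] exI[of _ a'] exI[of _ "4 + A"]) simp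
  qed
qed

text \<open>The loop does not stop at the outer test while \<open>k - 1 > 0\<close>, so the task is
  described by continuations: every complete run from the returned state extends to one from the
  initial state at extra cost \<open>C\<close>, \<open>D\<close>. The offsets 3 and 1 match the
  recursion tree, having one inner node fewer than leaves. Preservation of the cells below
  \<open>k\<close> lets the enclosing levels resume.\<close>

lemma exec_main_loop_level:
  assumes "0 < m" "m \<le> N" "0 < k"
    and "\<sigma> vk = int k" "\<sigma> vx = int m" "\<sigma> vy = int N - int m"
  shows "\<exists>\<sigma>' a' C D. C + 3 = 4 * card (partitions_ge m N) + 4 * card (partitions2_ge m N) \<and>
    D + 1 = card (partitions_ge m N) + 3 * card (partitions2_ge m N) \<and>
    \<sigma>' vk = int k - 1 \<and> \<sigma>' vx = a' (k - 1) + 1 \<and> \<sigma>' vy = int N - 1 \<and> (\<forall>i<k. a' i = a i) \<and>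
    (\<forall>A B s'. exec main_loop (\<sigma>', a') A B s' \<longrightarrow> exec main_loop (\<sigma>, a) (C + A) (D + B) s')"
  using assms
\<comment> \<open>The difference decreases for both subtasks \<open>(m, N - m)\<close> and
  \<open>(m + 1, N)\<close>, as \<open>m > 0\<close>.\<close>
proof (induction "N - m" arbitrary: m N k \<sigma> a rule: less_induct)
  case less
  show ?case
  proof (cases "3 * m \<le> N")
    case False
    let ?\<sigma>1 = "\<sigma>(vt := \<sigma> vk + 1)"
    have push: "exec push_loop (\<sigma>, a) 0 1 (\<sigma>, a)"
      unfolding push_loop_def using False less.prems
      by (intro exec.WhileFalse) (simp add: lift2_def)
    have vt: "exec (vt ::= Plus (Var vk) (Num 1)) (\<sigma>, a) 1 0 (?\<sigma>1, a)"
      by (intro exec.Assign) (simp add: lift2_def)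
    have "\<exists>\<sigma>2 a2 A. exec visit_loop (?\<sigma>1, a) A (card (partitions_ge m N)) (\<sigma>2, a2) \<and>
      A + 4 = 4 * card (partitions_ge m N) \<and>
      \<sigma>2 vk = int k \<and> \<sigma>2 vx + \<sigma>2 vy = int N \<and> (\<forall>i<k. a2 i = a i)"
      by (rule exec_visit_loop) (use False less.prems in auto)
    then obtain \<sigma>2 a2 A2 where
      visit: "exec visit_loop (?\<sigma>1, a) A2 (card (partitions_ge m N)) (\<sigma>2, a2)"
      and A2: "A2 + 4 = 4 * card (partitions_ge m N)"
      and s2: "\<sigma>2 vk = int k" "\<sigma>2 vx + \<sigma>2 vy = int N" "\<forall>i<k. a2 i = a i"
      by blast
    let ?\<sigma>' = "\<sigma>2(vy := \<sigma>2 vx + \<sigma>2 vy - 1, vk := \<sigma>2 vk - 1, vx := a2 (nat (\<sigma>2 vk - 1)) + 1)"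
    let ?a' = "a2(nat (\<sigma>2 vk) := \<sigma>2 vx + \<sigma>2 vy)"
    have pop: "exec pop (\<sigma>2, a2) 4 0 (?\<sigma>', ?a')"
      using less.prems s2 by (intro exec_pop) simp
    have body: "exec (push_loop ;; vt ::= Plus (Var vk) (Num 1) ;; visit_loop ;; pop) (\<sigma>, a)
      (0 + (1 + (A2 + 4))) (1 + (0 + (card (partitions_ge m N) + 0))) (?\<sigma>', ?a')"
      by (intro exec.Seq[OF push] exec.Seq[OF vt] exec.Seq[OF visit] pop)
    have "exec main_loop (\<sigma>, a) ((0 + (1 + (A2 + 4))) + A)
        (1 + (1 + (0 + (card (partitions_ge m N) + 0))) + B) s'"
      if "exec main_loop (?\<sigma>', ?a') A B s'" for A B s'
      using body that less.prems unfolding main_loop_def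
      by (intro exec.WhileTrue) (simp_all add: lift2_def)
    moreover have "card (partitions2_ge m N) = 1"
      using False less.prems partitions2_ge_singleton by simp
    moreover have "nat (int k - 1) = k - 1" by simp
    ultimately show ?thesis
      using A2 s2 less.prems
      by (intro exI[of _ ?\<sigma>'] exI[of _ ?a'], rule_tac x = "1 + (A2 + 4)" in exI,
          rule_tac x = "1 + (1 + card (partitions_ge m N))" in exI) auto
  next
    case True
    let ?\<sigma>1 = "\<sigma>(vy := \<sigma> vy - \<sigma> vx, vk := \<sigma> vk + 1)"
    let ?a1 = "a(nat (\<sigma> vk) := \<sigma> vx)"
    have "\<exists>\<sigma>' a' C D.
      C + 3 = 4 * card (partitions_ge m (N - m)) + 4 * card (partitions2_ge m (N - m)) \<and>
      D + 1 = card (partitions_ge m (N - m)) + 3 * card (partitions2_ge m (N - m)) \<and>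
      \<sigma>' vk = int (Suc k) - 1 \<and> \<sigma>' vx = a' (Suc k - 1) + 1 \<and> \<sigma>' vy = int (N - m) - 1 \<and>
      (\<forall>i<Suc k. a' i = ?a1 i) \<and>
      (\<forall>A B s'. exec main_loop (\<sigma>', a') A B s' \<longrightarrow> exec main_loop (?\<sigma>1, ?a1) (C + A) (D + B) s')"
      by (rule less.hyps) (use True less.prems in auto)
    then obtain \<sigma>2 a2 C2 D2 where
      CD2: "C2 + 3 = 4 * card (partitions_ge m (N - m)) + 4 * card (partitions2_ge m (N - m))"
        "D2 + 1 = card (partitions_ge m (N - m)) + 3 * card (partitions2_ge m (N - m))"
      and s2: "\<sigma>2 vk = int (Suc k) - 1" "\<sigma>2 vx = a2 (Suc k - 1) + 1" "\<sigma>2 vy = int (N - m) - 1"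
        "\<forall>i<Suc k. a2 i = ?a1 i"
      and exec2: "\<And>A B s'. exec main_loop (\<sigma>2, a2) A B s' \<Longrightarrow>
        exec main_loop (?\<sigma>1, ?a1) (C2 + A) (D2 + B) s'"
      by blast
    \<comment> \<open>The first subtask ran at level \<open>k + 1\<close>, so it returns with level
      \<open>k\<close>, \<open>x = a2 k + 1 = m + 1\<close> and \<open>y = N - m - 1\<close>:
      precisely the entry state of the task \<open>(m + 1, N)\<close> at level
      \<open>k\<close>.\<close>
    have "\<exists>\<sigma>' a' C D.
      C + 3 = 4 * card (partitions_ge (Suc m) N) + 4 * card (partitions2_ge (Suc m) N) \<and>
      D + 1 = card (partitions_ge (Suc m) N) + 3 * card (partitions2_ge (Suc m) N) \<and>
      \<sigma>' vk = int k - 1 \<and> \<sigma>' vx = a' (k - 1) + 1 \<and> \<sigma>' vy = int N - 1 \<and>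
      (\<forall>i<k. a' i = a2 i) \<and>
      (\<forall>A B s'. exec main_loop (\<sigma>', a') A B s' \<longrightarrow> exec main_loop (\<sigma>2, a2) (C + A) (D + B) s')"
      by (rule less.hyps) (use True less.prems s2 in auto)
    then obtain \<sigma>3 a3 C3 D3 where
      CD3: "C3 + 3 = 4 * card (partitions_ge (Suc m) N) + 4 * card (partitions2_ge (Suc m) N)"
        "D3 + 1 = card (partitions_ge (Suc m) N) + 3 * card (partitions2_ge (Suc m) N)"
      and s3: "\<sigma>3 vk = int k - 1" "\<sigma>3 vx = a3 (k - 1) + 1" "\<sigma>3 vy = int N - 1"
        "\<forall>i<k. a3 i = a2 i"
      and exec3: "\<And>A B s'. exec main_loop (\<sigma>3, a3) A B s' \<Longrightarrow>
        exec main_loop (\<sigma>2, a2) (C3 + A) (D3 + B) s'"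
      by blast
    have "exec main_loop (\<sigma>, a) (3 + C2 + C3 + A) (1 + D2 + D3 + B) s'"
      if "exec main_loop (\<sigma>3, a3) A B s'" for A B s'
    proof -
      have "exec main_loop (\<sigma>, a) (C2 + (C3 + A) + 3) (D2 + (D3 + B) + 1) s'"
        by (rule exec_main_loop_push) (use True less.prems exec2[OF exec3[OF that]] in auto)
      then show ?thesis by (simp add: algebra_simps)
    qed
    \<comment> \<open>The 3 assignments and 1 test of the push supply the second offset when the two
      subtask equations are added.\<close>
    moreover have
      "3 + C2 + C3 + 3 = 4 * card (partitions_ge m N) + 4 * card (partitions2_ge m N)"
      "1 + D2 + D3 + 1 = card (partitions_ge m N) + 3 * card (partitions2_ge m N)"
      using CD2 CD3 less.prems card_partitions_ge_rec[of m N] card_partitions2_ge_rec[of m N] True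
      by auto
    ultimately show ?thesis
      using s2(4) s3 less.prems
      by (intro exI[of _ \<sigma>3] exI[of _ a3], rule_tac x = "3 + C2 + C3" in exI,
          rule_tac x = "1 + D2 + D3" in exI) auto
  qed
qed

theorem theorem5:
  fixes n :: nat and \<sigma> :: "vname \<Rightarrow> int" and a :: "nat \<Rightarrow> int"
  assumes "0 < n" and "\<sigma> vn = int n"
  shows "\<exists>s'. exec algorithm_A (\<sigma>, a) (4 * num_partitions n + 4 * num_partitions2 n) (num_partitions n + 3 * num_partitions2 n) s'"
proof -
  let ?\<sigma>1 = "\<sigma>(vk := 1, vx := 1, vy := int n - 1)"
  have p: "card (partitions_ge 1 n) = num_partitions n"
    by (simp only: partitions_ge_1 num_partitions_def)
  have p2: "card (partitions2_ge 1 n) = num_partitions2 n"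
    by (simp only: partitions2_ge_def partitions_ge_1 num_partitions2_def)
  \<comment> \<open>The initial assignments set up the root task \<open>m = 1\<close>,
    \<open>N = n\<close> at level 1. It returns with \<open>k = 0\<close>, its last
    \<open>pop\<close> having read cell 0.\<close>
  have "\<exists>\<sigma>' a' C D. C + 3 = 4 * card (partitions_ge 1 n) + 4 * card (partitions2_ge 1 n) \<and>
    D + 1 = card (partitions_ge 1 n) + 3 * card (partitions2_ge 1 n) \<and>
    \<sigma>' vk = int 1 - 1 \<and> \<sigma>' vx = a' (1 - 1) + 1 \<and> \<sigma>' vy = int n - 1 \<and> (\<forall>i<1. a' i = a i) \<and>
    (\<forall>A B s'. exec main_loop (\<sigma>', a') A B s' \<longrightarrow> exec main_loop (?\<sigma>1, a) (C + A) (D + B) s')"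
    by (rule exec_main_loop_level) (use assms in auto)
  then obtain \<sigma>' a' C D where
    C: "C + 3 = 4 * num_partitions n + 4 * num_partitions2 n"
    and D: "D + 1 = num_partitions n + 3 * num_partitions2 n"
    and "\<sigma>' vk = 0"
    and loop: "\<And>A B s'. exec main_loop (\<sigma>', a') A B s' \<Longrightarrow> exec main_loop (?\<sigma>1, a) (C + A) (D + B) s'"
    unfolding p p2 by auto
  then have "exec main_loop (\<sigma>', a') 0 1 (\<sigma>', a')"
    unfolding main_loop_def by (intro exec.WhileFalse) (simp add: lift2_def)
  \<comment> \<open>The three initial assignments and the final failing test absorb the offsets of
    \<open>C\<close> and \<open>D\<close>.\<close>
  from loop[OF this] have "exec algorithm_A (\<sigma>, a) (1 + (1 + (1 + (C + 0)))) (D + 1) (\<sigma>', a')"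
    unfolding algorithm_A_eq
    by (intro exec_Assign_Seq) (auto simp: lift2_def assms)
  moreover have "1 + (1 + (1 + (C + 0))) = 4 * num_partitions n + 4 * num_partitions2 n"
    using C by simp
  ultimately show ?thesis using D by auto
qed

end
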